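(* A cubic graph $G$ admits an equiangular $\mathbb{S}^2$-immersion if and only if $G$ admits an $\mathbb{S}^2$-flow.
   Context: Graphs are finite. An orientation $\vec G$ of $G$ assigns to each edge $e$ a tail $\mathrm{init}(e)$ and a head $\mathrm{ter}(e)$; $E^+(v)$ (resp. $E^-(v)$) is the set of edges with tail (resp. head) $v$ and other end different from $v$. For an abelian group $\mathcal A$, an $\mathcal A$-flow on $\vec G$ is a map $\varphi:E(\vec G)\to\mathcal A\setminus\{0\}$ with $\sum_{e\in E^+(v)}\varphi(e)=\sum_{e\in E^-(v)}\varphi(e)$ for every vertex $v$; $G$ has an $\mathcal A$-flow if some (equivalently every) orientation does. An $\mathbb{S}^2$-flow is an $\mathbb{R}^3$-flow all of whose values are unit vectors. A great circle is $\pi\cap\mathbb{S}^2$ for a plane $\pi\subset\mathbb{R}^3$ through the origin; a geodesic arc is a closed nonempty connected subset of a great circle (a whole great circle is allowed). A directed geodesic arc is a continuous map $A:[0,1]\to\mathbb{S}^2$ with $A(x)\ne A(y)$ for $0\le x<y<1$, whose image is a geodesic arc, parametrized so that the length of $A([0,s])$ is $s$ times the length of $A([0,1])$. An $\mathbb{S}^2$-immersion of an oriented graph $\vec G$ is a map $\gamma$ assigning to each vertex $v$ a point $\gamma(v)\in\mathbb{S}^2$ and to each oriented edge $e$ from $u$ to $w$ a directed geodesic arc $\gamma(e)=A_e$ with $A_e(0)=\gamma(u)$, $A_e(1)=\gamma(w)$ (vertices need not map to distinct points, and arcs may overlap). For such an edge set $\gamma^{(1/3)}$ of the end at $u$ to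 be $A_e([0,1/3])$ and of the end at $w$ to be $A_e([2/3,1])$; the spherical angle between two such short arcs starting at the same point is the angle between their unit tangent vectors at that point, pointing away from it. For cubic $G$, an $\mathbb{S}^2$-immersion $\gamma$ of $\vec G$ is equiangular if for every vertex $v$ and every pair of distinct edge-ends at $v$, the spherical angle between the corresponding short arcs at $\gamma(v)$ is exactly $2\pi/3$. $G$ admits an equiangular $\mathbb{S}^2$-immersion if some orientation of $G$ does (equivalently every orientation does, reversing an edge by reparametrizing its arc as $t\mapsto A(1-t)$). *)

theory Defs
  imports "HOL-Analysis.Analysis" "HOL-Library.Uprod" "Graph_Theory.Digraph"
begin

section \<open>Graphs and orientations\<close>

text \<open>Parallel edges and loops are allowed; a loop at \<open>v\<close> is an edge \<open>e\<close> with
  \<open>ends G e = Upair v v\<close>.\<close>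

record ('v, 'e) multigraph =
  vertices :: "'v set"
  edges :: "'e set"
  ends :: "'e \<Rightarrow> 'v uprod"

definition finite_multigraph :: "('v, 'e) multigraph \<Rightarrow> bool" where
  "finite_multigraph G \<longleftrightarrow> finite (vertices G) \<and> finite (edges G) \<and>
     (\<forall>e\<in>edges G. set_uprod (ends G e) \<subseteq> vertices G)"

text \<open>A loop contributes to both summands, hence counts twice.\<close>

definition degree :: "('v, 'e) multigraph \<Rightarrow> 'v \<Rightarrow> nat" where
  "degree G v = card {e\<in>edges G. v \<in> set_uprod (ends G e)}
              + card {e\<in>edges G. ends G e = Upair v v}"

definition cubic :: "('v, 'e) multigraph \<Rightarrow> bool" where
  "cubic G \<longleftrightarrow> (\<forall>v\<in>vertices G. degree G v = 3)"

definition orientation_of :: "('v, 'e) pre_digraph \<Rightarrow> ('v, 'e) multigraph \<Rightarrow> bool" where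
  "orientation_of D G \<longleftrightarrow> verts D = vertices G \<and> arcs D = edges G \<and>
     (\<forall>e\<in>edges G. ends G e = Upair (tail D e) (head D e))"

section \<open>Flows\<close>

text \<open>Removing \<open>in_arcs D v\<close> from \<open>out_arcs D v\<close> (and vice versa) removes exactly the loops
  at \<open>v\<close>, so the two sums range over \<open>E\<^sup>+(v)\<close> and \<open>E\<^sup>-(v)\<close>.\<close>

definition is_flow :: "('v, 'e) pre_digraph \<Rightarrow> ('e \<Rightarrow> 'a::ab_group_add) \<Rightarrow> bool" where
  "is_flow D \<phi> \<longleftrightarrow> (\<forall>e\<in>arcs D. \<phi> e \<noteq> 0) \<and>
     (\<forall>v\<in>verts D. (\<Sum>e\<in>out_arcs D v - in_arcs D v. \<phi> e) = (\<Sum>e\<in>in_arcs D v - out_arcs D v. \<phi> e))"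

definition is_S2_flow :: "('v, 'e) pre_digraph \<Rightarrow> ('e \<Rightarrow> real^3) \<Rightarrow> bool" where
  "is_S2_flow D \<phi> \<longleftrightarrow> is_flow D \<phi> \<and> (\<forall>e\<in>arcs D. \<phi> e \<in> sphere 0 1)"

definition has_S2_flow :: "('v, 'e) multigraph \<Rightarrow> bool" where
  "has_S2_flow G \<longleftrightarrow> (\<exists>D \<phi>. orientation_of D G \<and> is_S2_flow D \<phi>)"

section \<open>Geodesic arcs on the sphere\<close>

definition great_circle :: "(real^3) set \<Rightarrow> bool" where
  "great_circle C \<longleftrightarrow> (\<exists>P. subspace P \<and> dim P = 2 \<and> C = P \<inter> sphere 0 1)"

definition geodesic_arc :: "(real^3) set \<Rightarrow> bool" where
  "geodesic_arc S \<longleftrightarrow> closed S \<and> S \<noteq> {} \<and> connected S \<and> (\<exists>C. great_circle C \<and> S \<subseteq> C)"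

text \<open>Length of the path \<open>g\<close> over \<open>[0,1]\<close>: the supremum of the lengths of inscribed polygons.\<close>

definition path_length :: "(real \<Rightarrow> 'a::metric_space) \<Rightarrow> ennreal" where
  "path_length g = (SUP (n, t) \<in> UNIV \<times> {t :: nat \<Rightarrow> real. mono t \<and> range t \<subseteq> {0..1}}.
     ennreal (\<Sum>i<n. dist (g (t i)) (g (t (Suc i)))))"

text \<open>The path \<open>subpath 0 s A\<close> runs through \<open>A([0,s])\<close>. It does so without repetition, except that
  the endpoints of the whole of \<open>A\<close> may coincide, so its path length is the length of \<open>A([0,s])\<close>.\<close>

definition directed_geodesic_arc :: "(real \<Rightarrow> real^3) \<Rightarrow> bool" where
  "directed_geodesic_arc A \<longleftrightarrow> path A \<and>
     (\<forall>x y. 0 \<le> x \<and> x < y \<and> y < 1 \<longrightarrow> A x \<noteq> A y) \<and>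
     geodesic_arc (path_image A) \<and>
     (\<forall>s\<in>{0..1}. path_length (subpath 0 s A) = ennreal s * path_length A)"

section \<open>Equiangular immersions\<close>

text \<open>An immersion is given by a map \<open>p\<close> on the vertices and a map \<open>A\<close> on the edges.\<close>

definition is_S2_immersion ::
    "('v, 'e) pre_digraph \<Rightarrow> ('v \<Rightarrow> real^3) \<Rightarrow> ('e \<Rightarrow> real \<Rightarrow> real^3) \<Rightarrow> bool" where
  "is_S2_immersion D p A \<longleftrightarrow> (\<forall>v\<in>verts D. p v \<in> sphere 0 1) \<and>
     (\<forall>e\<in>arcs D. directed_geodesic_arc (A e) \<and>
        pathstart (A e) = p (tail D e) \<and> pathfinish (A e) = p (head D e))"

text \<open>\<open>Inl e\<close> is the end of \<open>e\<close> at its tail and \<open>Inr e\<close> the end at its head, so a loop has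
  two distinct ends at its vertex.\<close>

definition edge_ends_at :: "('v, 'e) pre_digraph \<Rightarrow> 'v \<Rightarrow> ('e + 'e) set" where
  "edge_ends_at D v = out_arcs D v <+> in_arcs D v"

text \<open>The short arcs \<open>A([0,1/3])\<close> and \<open>A([2/3,1])\<close>, both parametrized so as to start at the
  vertex; the second one is therefore traversed backwards, from \<open>A(1)\<close> to \<open>A(2/3)\<close>.\<close>

fun short_arc :: "('e \<Rightarrow> real \<Rightarrow> real^3) \<Rightarrow> 'e + 'e \<Rightarrow> real \<Rightarrow> real^3" where
  "short_arc A (Inl e) = subpath 0 (1/3) (A e)"
| "short_arc A (Inr e) = subpath 1 (2/3) (A e)"

definition initial_unit_tangent :: "(real \<Rightarrow> real^3) \<Rightarrow> real^3" where
  "initial_unit_tangent c = sgn (vector_derivative c (at 0 within {0..1}))"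

definition spherical_angle :: "(real \<Rightarrow> real^3) \<Rightarrow> (real \<Rightarrow> real^3) \<Rightarrow> real" where
  "spherical_angle c d = arccos (initial_unit_tangent c \<bullet> initial_unit_tangent d)"

definition equiangular ::
    "('v, 'e) pre_digraph \<Rightarrow> ('e \<Rightarrow> real \<Rightarrow> real^3) \<Rightarrow> bool" where
  "equiangular D A \<longleftrightarrow> (\<forall>v\<in>verts D. \<forall>x\<in>edge_ends_at D v. \<forall>y\<in>edge_ends_at D v.
     x \<noteq> y \<longrightarrow> spherical_angle (short_arc A x) (short_arc A y) = 2 * pi / 3)"

definition has_equiangular_S2_immersion :: "('v, 'e) multigraph \<Rightarrow> bool" where
  "has_equiangular_S2_immersion G \<longleftrightarrow>
     (\<exists>D p A. orientation_of D G \<and> is_S2_immersion D p A \<and> equiangular D A)"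

end

theory Submission
  imports Defs
begin

text \<open>A flow value \<open>\<phi> e\<close> is the oriented unit normal of the great circle carrying the arc of \<open>e\<close>.
  Then \<open>\<phi> e\<close> is orthogonal to both end points of the arc, and the unit tangents at its two ends,
  pointing inwards, are the cross products of \<open>\<phi> e\<close> and \<open>- \<phi> e\<close> with the respective end points.
  So the angles at a vertex are those between the three signed flow values there, and
  three unit vectors make pairwise angles \<open>2 * pi / 3\<close> iff they sum to zero. Conversely, three
  vectors with sum zero are coplanar; mapping the vertex to a unit normal of their plane makes
  both end points of an edge orthogonal to its flow value, hence joined by an arc about it.\<close>

section \<open>Arcs of great circles\<close>

text \<open>For orthonormal \<open>a\<close> and \<open>b\<close>, the unit-speed parametrization of
  their great circle, from \<open>a\<close> towards \<open>b\<close>.\<close>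

definition circ :: "'a \<Rightarrow> 'a \<Rightarrow> real \<Rightarrow> 'a::real_inner" where
  "circ a b t = cos t *\<^sub>R a + sin t *\<^sub>R b"

section \<open>Distances and lengths along a parametrized great circle\<close>

lemma circ_inner:
  assumes "norm a = 1" "norm b = 1" "a \<bullet> b = 0"
  shows "circ a b x \<bullet> circ a b y = cos (x - y)"
proof -
  have "a \<bullet> a = 1" "b \<bullet> b = 1" "b \<bullet> a = 0"
    using assms by (simp_all add: norm_eq_1 inner_commute)
  then show ?thesis
    using assms(3) by (simp add: circ_def inner_add_left inner_add_right cos_diff)
qed

lemma norm_circ:
  assumes "norm a = 1" "norm b = 1" "a \<bullet> b = 0"
  shows "norm (circ a b x) = 1"
  using circ_inner[OF assms, of x x] by (simp add: norm_eq_1)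

lemma dist_circ:
  assumes "norm a = 1" "norm b = 1" "a \<bullet> b = 0"
  shows "dist (circ a b x) (circ a b y) = 2 * \<bar>sin ((y - x) / 2)\<bar>"
proof -
  let ?u = "circ a b x" and ?v = "circ a b y"
  have "cos (y - x) = 1 - 2 * (sin ((y - x) / 2))\<^sup>2"
    using cos_double_sin[of "(y - x) / 2"] by (simp only: mult_2 field_sum_of_halves)
  moreover have "(norm (?u - ?v))\<^sup>2 = 2 - 2 * cos (y - x)"
    using norm_circ[OF assms] circ_inner[OF assms, of y x]
    by (simp add: power2_norm_eq_inner inner_diff_left inner_diff_right inner_commute
        norm_eq_1)
  ultimately have "(dist ?u ?v)\<^sup>2 = (2 * \<bar>sin ((y - x) / 2)\<bar>)\<^sup>2"
    by (simp add: dist_norm power_mult_distrib)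
  then show ?thesis
    by (rule power2_eq_imp_eq) auto
qed

lemma circ_minus: "circ a (- b) (- t) = circ a b t"
  by (simp add: circ_def)

lemma continuous_on_circ [continuous_intros]:
  fixes f :: "'b::t2_space \<Rightarrow> real"
  shows "continuous_on S f \<Longrightarrow> continuous_on S (\<lambda>x. circ a b (f x))"
  unfolding circ_def by (intro continuous_intros)

text \<open>The lower bound comes from the inscribed polygon whose vertices divide the angle
  into \<open>n\<close> equal parts; its length is \<open>2 n sin (\<Delta> / 2 n)\<close>.\<close>

lemma path_length_circ:
  fixes a b :: "'a::real_inner"
  assumes ab: "norm a = 1" "norm b = 1" "a \<bullet> b = 0"
    and cont: "continuous_on {0..1} \<alpha>" and mono: "mono_on {0..1} \<alpha>"
    and g: "\<And>s. s \<in> {0..1} \<Longrightarrow> g s = circ a b (\<alpha> s)"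
  shows "path_length g = ennreal (\<alpha> 1 - \<alpha> 0)"
proof (rule antisym)
  have "(\<Sum>i<n. dist (g (t i)) (g (t (Suc i)))) \<le> \<alpha> 1 - \<alpha> 0"
    if t: "mono t" "range t \<subseteq> {0..1}" for n and t :: "nat \<Rightarrow> real"
  proof -
    have t01: "t i \<in> {0..1}" for i using t(2) by blast
    \<comment> \<open>A chord is at most as long as its arc, and the angle increments
      telescope.\<close>
    have "dist (g (t i)) (g (t (Suc i))) \<le> \<alpha> (t (Suc i)) - \<alpha> (t i)" for i
    proof -
      have "\<alpha> (t i) \<le> \<alpha> (t (Suc i))"
        using t01 monoD[OF t(1), of i "Suc i"] by (intro mono_onD[OF mono]) auto
      then show ?thesis
        using abs_sin_x_le_abs_x[of "(\<alpha> (t (Suc i)) - \<alpha> (t i)) / 2"] t01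
        by (simp add: g dist_circ[OF ab])
    qed
    then have "(\<Sum>i<n. dist (g (t i)) (g (t (Suc i)))) \<le> (\<Sum>i<n. \<alpha> (t (Suc i)) - \<alpha> (t i))"
      by (intro sum_mono)
    also have "\<dots> = \<alpha> (t n) - \<alpha> (t 0)"
      by (rule sum_lessThan_telescope)
    also have "\<dots> \<le> \<alpha> 1 - \<alpha> 0"
      using t01[of n] t01[of 0] by (intro diff_mono mono_onD[OF mono]) auto
    finally show ?thesis .
  qed
  then show "path_length g \<le> ennreal (\<alpha> 1 - \<alpha> 0)"
    unfolding path_length_def by (intro SUP_least) (auto intro: ennreal_leI)
next
  define \<Delta> where "\<Delta> = \<alpha> 1 - \<alpha> 0"
  have \<Delta>0: "\<Delta> \<ge> 0" unfolding \<Delta>_def using mono_onD[OF mono, of 0 1] by simp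
  have bound: "ennreal (real n * (2 * \<bar>sin (\<Delta> / real n / 2)\<bar>)) \<le> path_length g"
    if n: "n > 0" for n
  \<comment> \<open>For \<Delta> = 0 the bound is 0. Otherwise the division angles are strictly
    ordered, and this orders their preimages.\<close>
  proof (cases "\<Delta> = 0")
    case False
    have "\<exists>x. x \<in> {0..1} \<and> \<alpha> x = \<alpha> 0 + real (min i n) / n * \<Delta>" for i
    proof -
      have "real (min i n) / n * \<Delta> \<le> 1 * \<Delta>"
        using \<Delta>0 n by (intro mult_right_mono) (auto simp: divide_simps)
      then have "\<exists>x\<ge>0. x \<le> 1 \<and> \<alpha> x = \<alpha> 0 + real (min i n) / n * \<Delta>"
        using \<Delta>0 by (intro IVT' cont) (auto simp: \<Delta>_def)
      then show ?thesis by auto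
    qed
    then obtain t where t: "\<And>i. t i \<in> {0..1}"
      and \<alpha>t: "\<And>i. \<alpha> (t i) = \<alpha> 0 + real (min i n) / n * \<Delta>" by metis
    \<comment> \<open>The choices \<open>t i\<close> for \<open>i\<close> beyond \<open>n\<close>
      share one angle but need not agree; capping the index makes \<open>u\<close> constant there,
      so that it is monotone on all naturals.\<close>
    define u where "u i = t (min i n)" for i
    have "mono u"
    proof (rule monoI, rule ccontr)
      fix i j :: nat assume ij: "i \<le> j" "\<not> u i \<le> u j"
      then have "min i n < min j n"
        by (cases "min i n = min j n") (auto simp: u_def)
      then have "real (min i n) / n * \<Delta> < real (min j n) / n * \<Delta>"
        using n \<Delta>0 False by (intro mult_strict_right_mono divide_strict_right_mono) auto
      moreover have "\<alpha> (u j) \<le> \<alpha> (u i)"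
        using ij t by (intro mono_onD[OF mono]) (auto simp: u_def)
      ultimately show False by (simp add: u_def \<alpha>t)
    qed
    moreover have "range u \<subseteq> {0..1}" using t by (auto simp: u_def)
    moreover have "(\<Sum>i<n. dist (g (u i)) (g (u (Suc i)))) = real n * (2 * \<bar>sin (\<Delta> / real n / 2)\<bar>)"
    proof -
      have "dist (g (u i)) (g (u (Suc i))) = 2 * \<bar>sin (\<Delta> / real n / 2)\<bar>" if "i < n" for i
      proof -
        have "\<alpha> (t (Suc i)) - \<alpha> (t i) = \<Delta> / n"
          using that n by (simp add: \<alpha>t field_simps)
        then show ?thesis using that t by (simp add: u_def g dist_circ[OF ab])
      qed
      then show ?thesis by simp
    qed
    ultimately show ?thesis
      unfolding path_length_def by (intro SUP_upper2[of "(n, u)"]) auto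
  qed simp
  have lim: "(\<lambda>n. real n * (2 * \<bar>sin (\<Delta> / real n / 2)\<bar>)) \<longlonglongrightarrow> \<Delta>"
  proof -
    have eq: "\<bar>2 * (sin (\<Delta> / 2 * inverse m) / inverse m)\<bar> = m * (2 * \<bar>sin (\<Delta> / m / 2)\<bar>)"
      if "m > 0" for m :: real
    proof -
      have "\<Delta> / 2 * inverse m = \<Delta> / m / 2" by (simp add: field_simps)
      then show ?thesis
        using that unfolding \<open>\<Delta> / 2 * inverse m = \<Delta> / m / 2\<close> by (simp add: abs_mult field_simps)
    qed
    \<comment> \<open>The limit is a derivative of a sine at 0, sampled at the points 1 / (n +
      1).\<close>
    have "((\<lambda>x. sin (\<Delta> / 2 * x)) has_field_derivative cos (\<Delta> / 2 * 0) * (\<Delta> / 2)) (at 0)"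
      by (auto intro!: derivative_eq_intros)
    then have "((\<lambda>x. sin (\<Delta> / 2 * x) / x) \<longlongrightarrow> \<Delta> / 2) (at 0)"
      by (simp add: has_field_derivative_iff)
    then have "(\<lambda>n. sin (\<Delta> / 2 * inverse (real (Suc n))) / inverse (real (Suc n))) \<longlonglongrightarrow> \<Delta> / 2"
      by (rule filterlim_compose)
        (use LIMSEQ_inverse_real_of_nat in \<open>auto simp: filterlim_at\<close>)
    then have "(\<lambda>n. \<bar>2 * (sin (\<Delta> / 2 * inverse (real (Suc n))) / inverse (real (Suc n)))\<bar>)
        \<longlonglongrightarrow> \<bar>2 * (\<Delta> / 2)\<bar>"
      by (intro tendsto_rabs tendsto_mult_left)
    then have "(\<lambda>n. real (Suc n) * (2 * \<bar>sin (\<Delta> / real (Suc n) / 2)\<bar>)) \<longlonglongrightarrow> \<Delta>"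
      using \<Delta>0 by (simp only: eq[OF of_nat_0_less_iff[THEN iffD2, OF zero_less_Suc]]) simp
    then show ?thesis by (rule LIMSEQ_imp_Suc)
  qed
  have "(\<lambda>n. ennreal (real n * (2 * \<bar>sin (\<Delta> / real n / 2)\<bar>))) \<longlonglongrightarrow> ennreal \<Delta>"
    using lim by (rule tendsto_ennrealI)
  then show "ennreal (\<alpha> 1 - \<alpha> 0) \<le> path_length g"
    unfolding \<Delta>_def[symmetric]
    by (rule LIMSEQ_le_const2) (use bound in \<open>auto intro!: exI[of _ 1]\<close>)
qed

section \<open>Tangents and axes of arcs\<close>

text \<open>\<open>circ b (- a)\<close> is the derivative of \<open>circ a b\<close>. Normalizing
  keeps only the sign of the speed \<open>k\<close>, which is the sense of traversal.\<close>

lemma initial_unit_tangent_circ: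
  fixes a b :: "real^3"
  assumes ab: "norm a = 1" "norm b = 1" "a \<bullet> b = 0" and "k \<noteq> 0"
    and g: "\<And>s. s \<in> {0..1} \<Longrightarrow> g s = circ a b (c + k * s)"
  shows "initial_unit_tangent g = sgn k *\<^sub>R circ b (- a) c"
proof -
  have "((\<lambda>s. circ a b (c + k * s)) has_vector_derivative k *\<^sub>R circ b (- a) c) (at 0 within {0..1})"
    unfolding circ_def has_vector_derivative_def
    by (rule derivative_eq_intros refl | simp)+
      (simp add: algebra_simps fun_eq_iff)
  then have "(g has_vector_derivative k *\<^sub>R circ b (- a) c) (at 0 within {0..1})"
    by (rule has_vector_derivative_transform[rotated 2]) (use g in auto)
  then have "vector_derivative g (at 0 within {0..1}) = k *\<^sub>R circ b (- a) c"
    by (intro vector_derivative_within_closed_interval) auto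
  moreover have "norm (circ b (- a) c) = 1"
    using ab by (intro norm_circ) (auto simp: inner_commute)
  ultimately show ?thesis
    by (simp add: initial_unit_tangent_def sgn_scaleR) (simp add: sgn_div_norm)
qed

text \<open>Crossing with the normal \<open>cross3 a b\<close> is the quarter turn in the plane of
  \<open>a\<close> and \<open>b\<close>, by the expansion of a double cross product.\<close>

lemma cross3_circ:
  assumes "norm a = 1" "norm b = 1" "a \<bullet> b = 0"
  shows "cross3 (cross3 a b) (circ a b t) = circ b (- a) t"
proof -
  have *: "a \<bullet> a = 1" "b \<bullet> b = 1" "b \<bullet> a = 0"
    using assms by (simp_all add: norm_eq_1 inner_commute)
  have "cross3 (cross3 a b) x = (x \<bullet> a) *\<^sub>R b - (x \<bullet> b) *\<^sub>R a" for x
    by (subst cross_skew) (simp add: Lagrange)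
  then show ?thesis
    by (simp only: circ_def) (simp add: inner_add_left * assms(3))
qed

text \<open>The oriented unit normal about which the arc turns positively, recorded only through its
  effect at the two ends, which is all that the angles see. The minus sign arises because the short
  arc at the head is traversed backwards.\<close>

definition arc_axis :: "(real \<Rightarrow> real^3) \<Rightarrow> real^3 \<Rightarrow> bool" where
  "arc_axis A n \<longleftrightarrow> norm n = 1 \<and> n \<bullet> pathstart A = 0 \<and> n \<bullet> pathfinish A = 0 \<and>
     initial_unit_tangent (subpath 0 (1/3) A) = cross3 n (pathstart A) \<and>
     initial_unit_tangent (subpath 1 (2/3) A) = - cross3 n (pathfinish A)"

lemma arc_axis_circ:
  fixes a b :: "real^3"
  assumes ab: "norm a = 1" "norm b = 1" "a \<bullet> b = 0" and "k > 0"
    and A: "\<And>s. s \<in> {0..1} \<Longrightarrow> A s = circ a b (c + k * s)"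
  shows "arc_axis A (cross3 a b)"
proof -
  have orth: "cross3 a b \<bullet> circ a b t = 0" for t
    by (simp add: circ_def inner_add_right dot_cross_self)
  have "(norm (cross3 a b))\<^sup>2 = 1"
    by (simp add: norm_cross ab)
  then have "norm (cross3 a b) = 1"
    by (metis norm_ge_zero one_power2 power2_eq_imp_eq zero_le_one)
  moreover have "initial_unit_tangent (subpath 0 (1/3) A) = sgn (k/3) *\<^sub>R circ b (- a) c"
    using \<open>k > 0\<close> by (intro initial_unit_tangent_circ[OF ab]) (auto simp: subpath_def A)
  \<comment> \<open>From 1 to 2/3 the angle starts at \<open>c + k\<close> and runs at speed
    \<open>- k/3\<close>.\<close>
  moreover have "initial_unit_tangent (subpath 1 (2/3) A) = sgn (- k/3) *\<^sub>R circ b (- a) (c + k)"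
    using \<open>k > 0\<close>
    by (intro initial_unit_tangent_circ[OF ab]) (auto simp: subpath_def A algebra_simps)
  ultimately show ?thesis
    using \<open>k > 0\<close>
    by (simp add: arc_axis_def pathstart_def pathfinish_def A orth cross3_circ[OF ab] sgn_minus)
qed


section \<open>Construction of directed geodesic arcs\<close>

text \<open>Constant speed makes length proportional to the parameter, and a total angle of at most
  2 pi gives injectivity before the end point.\<close>

lemma directed_geodesic_arc_circ:
  fixes a b :: "real^3"
  assumes ab: "norm a = 1" "norm b = 1" "a \<bullet> b = 0" and k: "0 < k" "k \<le> 2 * pi"
  shows "directed_geodesic_arc (\<lambda>s. circ a b (k * s))"
  unfolding directed_geodesic_arc_def
proof (intro conjI allI impI ballI)
  let ?A = "\<lambda>s. circ a b (k * s)"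
  show path: "path ?A"
    unfolding path_def by (intro continuous_intros)
  show "?A x \<noteq> ?A y" if xy: "0 \<le> x \<and> x < y \<and> y < 1" for x y
  proof
    assume "?A x = ?A y"
    then have "?A y \<bullet> ?A x = 1"
      using norm_circ[OF ab] by (simp add: norm_eq_1)
    \<comment> \<open>Equal points differ in angle by a multiple of 2 pi, yet
      \<open>k * (y - x)\<close> lies strictly between 0 and 2 pi.\<close>
    then have "cos (k * (y - x)) = 1"
      by (simp add: circ_inner[OF ab] algebra_simps)
    then obtain m :: int where m: "k * (y - x) = of_int m * (2 * pi)"
      by (auto simp: cos_one_2pi_int mult.assoc)
    have "0 < k * (y - x)" using k xy by simp
    then have "0 < of_int m * (2 * pi)" using m by simp
    then have "m \<ge> 1" by (simp add: zero_less_mult_iff)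
    have "k * (y - x) < k * 1" using k xy by (intro mult_strict_left_mono) auto
    moreover have "1 * (2 * pi) \<le> of_int m * (2 * pi)"
      using \<open>m \<ge> 1\<close> by (intro mult_right_mono) auto
    ultimately show False using m k by linarith
  qed
  show "geodesic_arc (path_image ?A)"
    unfolding geodesic_arc_def great_circle_def
  proof (intro conjI exI)
    show "closed (path_image ?A)" "connected (path_image ?A)"
      using path by (simp_all add: closed_path_image connected_path_image)
    show "path_image ?A \<noteq> {}" by simp
    let ?P = "{x. cross3 a b \<bullet> x = 0}"
    show "subspace ?P" by (rule subspace_hyperplane)
    have "(norm (cross3 a b))\<^sup>2 = 1" by (simp add: norm_cross ab)
    then have "cross3 a b \<noteq> 0" by auto
    then show "dim ?P = 2" by (simp add: dim_hyperplane)
    show "path_image ?A \<subseteq> ?P \<inter> sphere 0 1"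
      by (auto simp: path_image_def norm_circ[OF ab])
        (simp add: circ_def inner_add_right dot_cross_self)
  qed simp
  fix s :: real assume s: "s \<in> {0..1}"
  have len: "path_length (\<lambda>x. circ a b (c * x)) = ennreal c" if "c \<ge> 0" for c
    using path_length_circ[OF ab, of "\<lambda>x. c * x" "\<lambda>x. circ a b (c * x)"] that
    by (auto intro!: continuous_intros mono_onI mult_left_mono)
  show "path_length (subpath 0 s ?A) = ennreal s * path_length ?A"
    using len[of "k * s"] len[of k] s k
    by (simp add: subpath_def ennreal_mult'[symmetric] mult_ac)
qed

text \<open>Both points lie on the great circle orthogonal to \<open>n\<close>, so turning
  \<open>p\<close> positively about \<open>n\<close> reaches \<open>q\<close>. Antipodal points
  cause no ambiguity, since the axis fixes the circle.\<close>

lemma directed_geodesic_arc_exists: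
  fixes p q n :: "real^3"
  assumes "norm p = 1" "norm q = 1" "norm n = 1" "n \<bullet> p = 0" "n \<bullet> q = 0"
  obtains A where "directed_geodesic_arc A" "pathstart A = p" "pathfinish A = q" "arc_axis A n"
proof -
  \<comment> \<open>\<open>p\<close>, \<open>b\<close>, \<open>n\<close> form a right-handed
    orthonormal frame.\<close>
  define b where "b = cross3 n p"
  have pp: "p \<bullet> p = 1" "q \<bullet> q = 1" "n \<bullet> n = 1" "p \<bullet> n = 0" "q \<bullet> n = 0"
    using assms by (simp_all add: norm_eq_1 inner_commute)
  have n: "cross3 p b = n"
    by (simp add: b_def Lagrange pp)
  have "(norm b)\<^sup>2 = 1" unfolding b_def by (simp add: norm_cross assms)
  then have "norm b = 1" by (metis norm_ge_zero one_power2 power2_eq_imp_eq zero_le_one)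
  then have ab: "norm p = 1" "norm b = 1" "p \<bullet> b = 0"
    using assms by (simp_all add: b_def dot_cross_self)
  have "cross3 q n = cross3 q (cross3 p b)" by (simp add: n)
  also have "\<dots> = (q \<bullet> b) *\<^sub>R p - (q \<bullet> p) *\<^sub>R b" by (rule Lagrange)
  finally have qn: "cross3 q n = (q \<bullet> b) *\<^sub>R p - (q \<bullet> p) *\<^sub>R b" .
  \<comment> \<open>As \<open>q\<close> is orthogonal to \<open>n\<close>, two opposite quarter
    turns restore it; expanding them gives its coordinates in \<open>p\<close> and
    \<open>b\<close>.\<close>
  have "q = cross3 n (cross3 q n)" by (simp add: Lagrange pp assms)
  also have "\<dots> = (q \<bullet> b) *\<^sub>R b - (q \<bullet> p) *\<^sub>R cross3 n b"
    by (simp add: qn Cross3.right_diff_distrib cross_mult_right b_def[symmetric])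
  also have "cross3 n b = - p" by (simp add: b_def Lagrange pp assms)
  finally have q: "q = (q \<bullet> p) *\<^sub>R p + (q \<bullet> b) *\<^sub>R b"
    by (simp add: add.commute)
  have "q \<bullet> q = q \<bullet> ((q \<bullet> p) *\<^sub>R p + (q \<bullet> b) *\<^sub>R b)" by (subst q[symmetric]) simp
  then have "(q \<bullet> p)\<^sup>2 + (q \<bullet> b)\<^sup>2 = 1"
    by (simp add: inner_add_right power2_eq_square pp)
  then obtain t where t: "0 \<le> t" "t < 2 * pi" "q \<bullet> p = cos t" "q \<bullet> b = sin t"
    by (rule sincos_total_2pi)
  \<comment> \<open>For \<open>p = q\<close> the angle \<open>0\<close> would give a constant path; the whole circle is used instead.\<close>
  define k where "k = (if t = 0 then 2 * pi else t)"
  have k: "0 < k" "k \<le> 2 * pi" and qk: "q = circ p b k"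
    using t q by (auto simp: k_def circ_def)
  show thesis
  proof
    let ?A = "\<lambda>s. circ p b (k * s)"
    show "directed_geodesic_arc ?A" by (rule directed_geodesic_arc_circ[OF ab k])
    show "pathstart ?A = p" "pathfinish ?A = q"
      using qk by (simp_all add: pathstart_def pathfinish_def circ_def)
    show "arc_axis ?A n"
      using arc_axis_circ[OF ab k(1), of ?A 0] by (simp add: n)
  qed
qed

section \<open>Angle functions of arbitrary directed arcs\<close>

text \<open>A directed arc may close up at parameter 1, so injectivity is assumed only before it.
  The order found there extends to 1 by continuity.\<close>

lemma continuous_inj_on_halfopen_mono:
  fixes \<alpha> :: "real \<Rightarrow> real"
  assumes cont: "continuous_on {0..1} \<alpha>" and inj: "inj_on \<alpha> {0..<1}"
  shows "mono_on {0..1} \<alpha> \<or> mono_on {0..1} (\<lambda>s. - \<alpha> s)"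
proof -
  \<comment> \<open>After a change of sign the value at 0 is below that at 1/2, and this one
    comparison fixes the direction everywhere.\<close>
  have mono: "mono_on {0..1} \<beta>"
    if c: "continuous_on {0..1} \<beta>" and i: "inj_on \<beta> {0..<1}" and lt: "\<beta> 0 < \<beta> (1/2)"
    for \<beta> :: "real \<Rightarrow> real"
  proof -
    have *: "\<beta> a < \<beta> x \<and> \<beta> x < \<beta> b \<or> \<beta> b < \<beta> x \<and> \<beta> x < \<beta> a"
      if "0 \<le> a" "a < x" "x < b" "b < 1" for a x b
      using that by (intro continuous_inj_imp_mono continuous_on_subset[OF c] inj_on_subset[OF i]) auto
    have pos: "\<beta> 0 < \<beta> x" if "0 < x" "x < 1" for x
    proof (cases x "1/2 :: real" rule: linorder_cases)
      case equal
      then show ?thesis using lt by (simp only:)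
    qed (use *[of 0 x "1/2"] *[of 0 "1/2" x] that lt in auto)
    have halfopen: "\<beta> x \<le> \<beta> y" if "0 \<le> x" "x < y" "y < 1" for x y
      using *[of 0 x y] pos[of x] pos[of y] that by (cases "x = 0") auto
    have last: "\<beta> x \<le> \<beta> 1" if x: "0 \<le> x" "x < 1" for x
    proof (rule tendsto_lowerbound)
      show "(\<beta> \<longlongrightarrow> \<beta> 1) (at 1 within {0..1})"
        using c by (auto simp: continuous_on_def)
      show "eventually (\<lambda>y. \<beta> x \<le> \<beta> y) (at 1 within {0..1})"
        unfolding eventually_at
        by (rule exI[of _ "1 - x"]) (use x halfopen in \<open>auto simp: dist_real_def\<close>)
      show "at (1::real) within {0..1} \<noteq> bot"
        by (simp add: trivial_limit_within islimpt_Icc)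
    qed
    show ?thesis
    proof (rule mono_onI)
      fix r s :: real assume "r \<in> {0..1}" "s \<in> {0..1}" "r \<le> s"
      then show "\<beta> r \<le> \<beta> s"
        using halfopen[of r s] last[of r] by (cases "r = s"; cases "s = 1") auto
    qed
  qed
  have "\<alpha> 0 \<noteq> \<alpha> (1/2)"
    using inj_onD[OF inj, of 0 "1/2"] by auto
  then consider "\<alpha> 0 < \<alpha> (1/2)" | "- \<alpha> 0 < - \<alpha> (1/2)" by linarith
  then show ?thesis
  proof cases
    case 1
    then show ?thesis using mono[OF cont inj] by blast
  next
    case 2
    have "inj_on (\<lambda>s. - \<alpha> s) {0..<1}" using inj by (simp add: inj_on_def)
    then show ?thesis using mono[OF continuous_on_minus[OF cont] _ 2] by blast
  qed
qed

text \<open>A continuous angle along the arc is monotone by injectivity, and affine because arc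
  length equals the change of angle. Its direction decides which normal of the plane is the
  axis.\<close>

lemma directed_geodesic_arc_axis:
  assumes A: "directed_geodesic_arc A"
  obtains n where "arc_axis A n"
proof -
  have contA: "continuous_on {0..1} A"
    using A by (simp add: directed_geodesic_arc_def path_def)
  have injA: "A x \<noteq> A y" if "0 \<le> x" "x < y" "y < 1" for x y
    using A that by (auto simp: directed_geodesic_arc_def)
  have len: "path_length (subpath 0 s A) = ennreal s * path_length A" if "s \<in> {0..1}" for s
    using A that by (auto simp: directed_geodesic_arc_def)
  obtain P where P: "subspace P" "dim P = 2" "path_image A \<subseteq> P \<inter> sphere 0 1"
    using A by (auto simp: directed_geodesic_arc_def geodesic_arc_def great_circle_def)
  obtain B where B: "B \<subseteq> P" "pairwise orthogonal B" "\<And>x. x \<in> B \<Longrightarrow> norm x = 1"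
    "independent B" "card B = dim P" "span B = P"
    using orthonormal_basis_subspace[OF P(1)] by blast
  then obtain a b where Bab: "B = {a, b}" "a \<noteq> b"
    using P(2) by (metis card_2_iff)
  have ab: "norm a = 1" "norm b = 1" "a \<bullet> b = 0"
    using B Bab by (auto simp: pairwise_def orthogonal_def)
  have aa: "a \<bullet> a = 1" "b \<bullet> b = 1" "b \<bullet> a = 0"
    using ab by (simp_all add: norm_eq_1 inner_commute)
  have As: "A s = (A s \<bullet> a) *\<^sub>R a + (A s \<bullet> b) *\<^sub>R b" "norm (A s) = 1" if "s \<in> {0..1}" for s
  proof -
    have "A s \<in> P \<inter> sphere 0 1" using P(3) that unfolding path_image_def by blast
    then show "norm (A s) = 1" by simp
    have "A s \<in> span {a, b}" using \<open>A s \<in> P \<inter> sphere 0 1\<close> B(6) Bab by simp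
    then obtain x y where "A s = x *\<^sub>R a + y *\<^sub>R b"
      by (auto simp: span_insert span_singleton algebra_simps)
    then show "A s = (A s \<bullet> a) *\<^sub>R a + (A s \<bullet> b) *\<^sub>R b"
      by (simp add: inner_add_left aa ab)
  qed
  \<comment> \<open>An orthonormal basis identifies the plane with the complex numbers; a continuous
    logarithm of this path of modulus 1 supplies the angle.\<close>
  define f where "f s = Complex (A s \<bullet> a) (A s \<bullet> b)" for s
  have normf: "norm (f s) = 1" if "s \<in> {0..1}" for s
  proof -
    have "A s \<bullet> A s = A s \<bullet> ((A s \<bullet> a) *\<^sub>R a + (A s \<bullet> b) *\<^sub>R b)"
      using As(1)[OF that] by simp
    then have "(A s \<bullet> a)\<^sup>2 + (A s \<bullet> b)\<^sup>2 = 1"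
      using As(2)[OF that] by (simp add: inner_add_right power2_eq_square norm_eq_1)
    then show ?thesis by (simp add: f_def cmod_def)
  qed
  have "continuous_on {0..1} f"
    unfolding f_def by (intro continuous_intros contA)
  then obtain g where g: "continuous_on {0..1} g" "\<And>s. s \<in> {0..1} \<Longrightarrow> f s = exp (g s)"
    using continuous_logarithm_on_contractible[of "{0..1}" f] normf
    by (metis convex_imp_contractible convex_real_interval(5) norm_zero zero_neq_one)
  define \<alpha> where "\<alpha> s = Im (g s)" for s
  have cont\<alpha>: "continuous_on {0..1} \<alpha>"
    unfolding \<alpha>_def by (intro continuous_intros g)
  have A\<alpha>: "A s = circ a b (\<alpha> s)" if s: "s \<in> {0..1}" for s
  proof -
    have "exp (Re (g s)) = 1" using normf[OF s] g(2)[OF s] by simp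
    then have "Re (f s) = cos (\<alpha> s)" "Im (f s) = sin (\<alpha> s)"
      using g(2)[OF s] by (simp_all add: \<alpha>_def Re_exp Im_exp)
    then show ?thesis using As(1)[OF s] by (simp add: f_def circ_def)
  qed
  have inj\<alpha>: "inj_on \<alpha> {0..<1}"
  proof (rule linorder_inj_onI')
    fix i j :: real assume "i \<in> {0..<1}" "j \<in> {0..<1}" "i < j"
    then show "\<alpha> i \<noteq> \<alpha> j" using injA[of i j] A\<alpha>[of i] A\<alpha>[of j] by auto
  qed
  \<comment> \<open>Increasing angles suffice: replacing \<open>b\<close> by \<open>- b\<close>
    negates both the angle and the normal.\<close>
  have main: "arc_axis A (cross3 a b')"
    if ab': "norm a = 1" "norm b' = 1" "a \<bullet> b' = 0"
      and c: "continuous_on {0..1} \<beta>" and i: "inj_on \<beta> {0..<1}" and m: "mono_on {0..1} \<beta>"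
      and A\<beta>: "\<And>s. s \<in> {0..1} \<Longrightarrow> A s = circ a b' (\<beta> s)" for b' \<beta>
  proof -
    have le: "\<beta> 0 \<le> \<beta> s" if "s \<in> {0..1}" for s
      using that by (intro mono_onD[OF m]) auto
    \<comment> \<open>Both lengths in the constant-speed condition are increments of the
      angle.\<close>
    have "\<beta> s - \<beta> 0 = s * (\<beta> 1 - \<beta> 0)" if s: "s \<in> {0..1}" for s
    proof -
      have sx: "s * x \<in> {0..1}" if "x \<in> {0..1}" for x
        using s that by (auto intro: mult_le_one)
      have "path_length (subpath 0 s A) = ennreal (\<beta> (s * 1) - \<beta> (s * 0))"
      proof (rule path_length_circ[OF ab'])
        show "continuous_on {0..1} (\<lambda>x. \<beta> (s * x))"
          by (rule continuous_on_compose2[OF c]) (auto intro!: continuous_intros sx)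
        show "mono_on {0..1} (\<lambda>x. \<beta> (s * x))"
          using s by (intro mono_onI mono_onD[OF m] sx mult_left_mono) auto
        show "subpath 0 s A x = circ a b' (\<beta> (s * x))" if "x \<in> {0..1}" for x
          using A\<beta>[OF sx[OF that]] by (simp add: subpath_def)
      qed
      moreover have "path_length A = ennreal (\<beta> 1 - \<beta> 0)"
        by (rule path_length_circ[OF ab' c m A\<beta>])
      ultimately have "ennreal (\<beta> s - \<beta> 0) = ennreal (s * (\<beta> 1 - \<beta> 0))"
        using len[OF s] s le[of 1] by (simp add: ennreal_mult)
      then show ?thesis using s le[of s] le[of 1] by (subst (asm) ennreal_inj) auto
    qed
    note lin = this
    \<comment> \<open>Otherwise the affine angle would be constant, against injectivity.\<close>
    have "\<beta> 0 < \<beta> 1"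
    proof (rule ccontr)
      assume "\<not> \<beta> 0 < \<beta> 1"
      then have "\<beta> (1/2) = \<beta> 0" using lin[of "1/2"] le[of 1] by simp
      then show False using inj_onD[OF i, of "1/2" 0] by simp
    qed
    then show ?thesis
    proof (intro arc_axis_circ[OF ab'])
      show "A s = circ a b' (\<beta> 0 + (\<beta> 1 - \<beta> 0) * s)" if "s \<in> {0..1}" for s
      proof -
        have "\<beta> s = \<beta> 0 + (\<beta> 1 - \<beta> 0) * s" using lin[OF that] by (simp add: algebra_simps)
        then show ?thesis using A\<beta>[OF that] by simp
      qed
    qed simp
  qed
  from continuous_inj_on_halfopen_mono[OF cont\<alpha> inj\<alpha>] show thesis
  proof
    assume "mono_on {0..1} \<alpha>"
    then show thesis using main[OF ab cont\<alpha> inj\<alpha> _ A\<alpha>] that by blast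
  next
    assume m: "mono_on {0..1} (\<lambda>s. - \<alpha> s)"
    have "arc_axis A (cross3 a (- b))"
      using inj\<alpha> ab
      by (intro main[OF _ _ _ continuous_on_minus[OF cont\<alpha>] _ m])
        (auto simp: circ_minus A\<alpha> inj_on_def)
    then show thesis by (rule that)
  qed
qed

section \<open>Balanced triples of unit vectors\<close>

lemma arccos_eq_120_iff:
  assumes "\<bar>x\<bar> \<le> 1"
  shows "arccos x = 2 * pi / 3 \<longleftrightarrow> x = - 1 / 2"
proof
  assume "arccos x = 2 * pi / 3"
  then have "cos (2 * pi / 3) = x" using assms by (metis cos_arccos_abs)
  then show "x = - 1 / 2" by (simp add: cos_120)
next
  assume "x = - 1 / 2"
  then have "arccos x = arccos (cos (2 * pi / 3))" by (simp add: cos_120)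
  also have "\<dots> = 2 * pi / 3" by (intro arccos_cos) auto
  finally show "arccos x = 2 * pi / 3" .
qed

text \<open>Inner products of the zero sum with each vector form a linear system whose only solution
  is -1/2 for every pair. Conversely, these values make the squared norm of the sum 3 - 6/2 =
  0.\<close>

lemma unit_triple_sum_eq_0_iff:
  fixes u :: "'i \<Rightarrow> 'a::real_inner"
  assumes "card S = 3" and unit: "\<And>x. x \<in> S \<Longrightarrow> norm (u x) = 1"
  shows "(\<Sum>x\<in>S. u x) = 0 \<longleftrightarrow>
    (\<forall>x\<in>S. \<forall>y\<in>S. x \<noteq> y \<longrightarrow> arccos (u x \<bullet> u y) = 2 * pi / 3)"
proof -
  have arc: "arccos (u x \<bullet> u y) = 2 * pi / 3 \<longleftrightarrow> u x \<bullet> u y = - 1 / 2" if "x \<in> S" "y \<in> S" for x y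
    using Cauchy_Schwarz_ineq2[of "u x" "u y"] that unit by (intro arccos_eq_120_iff) auto
  obtain x y z where S: "S = {x, y, z}" "x \<noteq> y" "y \<noteq> z" "x \<noteq> z"
    using assms(1) by (auto simp: card_3_iff)
  define X Y Z where XYZ: "X = u x" "Y = u y" "Z = u z"
  have n: "X \<bullet> X = 1" "Y \<bullet> Y = 1" "Z \<bullet> Z = 1"
    using unit S by (simp_all add: XYZ norm_eq_1[symmetric])
  have "X + (Y + Z) = 0 \<longleftrightarrow> X \<bullet> Y = - 1 / 2 \<and> X \<bullet> Z = - 1 / 2 \<and> Y \<bullet> Z = - 1 / 2"
  proof
    assume 0: "X + (Y + Z) = 0"
    have "X \<bullet> (X + (Y + Z)) = 0" "Y \<bullet> (X + (Y + Z)) = 0" "Z \<bullet> (X + (Y + Z)) = 0"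
      by (simp_all only: 0 inner_zero_right)
    then show "X \<bullet> Y = - 1 / 2 \<and> X \<bullet> Z = - 1 / 2 \<and> Y \<bullet> Z = - 1 / 2"
      by (simp add: inner_add_right n inner_commute[of Y X]
          inner_commute[of Z X] inner_commute[of Z Y])
  next
    assume "X \<bullet> Y = - 1 / 2 \<and> X \<bullet> Z = - 1 / 2 \<and> Y \<bullet> Z = - 1 / 2"
    then have "(X + (Y + Z)) \<bullet> (X + (Y + Z)) = 0"
      by (simp add: inner_add_right inner_add_left n inner_commute[of Y X]
          inner_commute[of Z X] inner_commute[of Z Y])
    then show "X + (Y + Z) = 0" by simp
  qed
  moreover have "(\<Sum>x\<in>S. u x) = X + (Y + Z)" using S by (simp add: XYZ)
  moreover have "(\<forall>x\<in>S. \<forall>y\<in>S. x \<noteq> y \<longrightarrow> arccos (u x \<bullet> u y) = 2 * pi / 3) \<longleftrightarrow>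
      (\<forall>x\<in>S. \<forall>y\<in>S. x \<noteq> y \<longrightarrow> u x \<bullet> u y = - 1 / 2)"
    using arc by blast
  ultimately show ?thesis
    using S by (auto simp: XYZ inner_commute)
qed

text \<open>The zero sum puts the third vector into the span of the other two, of dimension at most
  2, which has a normal in space.\<close>

lemma unit_orthogonal_triple_exists:
  fixes u :: "'i \<Rightarrow> real^3"
  assumes "card S = 3" "(\<Sum>x\<in>S. u x) = 0"
  obtains p where "norm p = 1" "\<And>x. x \<in> S \<Longrightarrow> u x \<bullet> p = 0"
proof -
  obtain x y z where S: "S = {x, y, z}" "x \<noteq> y" "y \<noteq> z" "x \<noteq> z"
    using assms(1) by (auto simp: card_3_iff)
  have z: "u z = - u x - u y" using assms(2) S by (simp add: eq_neg_iff_add_eq_0 algebra_simps)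
  have "dim {u x, u y} \<le> card {u x, u y}" by (rule dim_le_card') simp
  also have "\<dots> < DIM(real^3)" by (auto intro: le_less_trans[OF card_insert_le_m1])
  finally obtain q where q: "q \<noteq> 0" "\<And>v. v \<in> span {u x, u y} \<Longrightarrow> orthogonal q v"
    using orthogonal_to_subspace_exists by blast
  show thesis
  proof
    show "norm (sgn q) = 1" using q(1) by (simp add: norm_sgn)
    have "u x \<bullet> q = 0" "u y \<bullet> q = 0"
      using q(2)[of "u x"] q(2)[of "u y"]
      by (simp_all add: span_base orthogonal_def inner_commute)
    then show "u w \<bullet> sgn q = 0" if "w \<in> S" for w
      using that S z by (auto simp: sgn_div_norm inner_diff_left)
  qed
qed

section \<open>Edge ends\<close>

text \<open>Outflow counts as positive; the signs agree with those of the two tangents in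
  \<open>arc_axis\<close>.\<close>

fun signed_value :: "('e \<Rightarrow> 'a::ab_group_add) \<Rightarrow> 'e + 'e \<Rightarrow> 'a" where
  "signed_value \<phi> (Inl e) = \<phi> e"
| "signed_value \<phi> (Inr e) = - \<phi> e"

text \<open>The two ends of a loop cancel, so this sum is the net flow over non-loop edges.\<close>

lemma sum_signed_value:
  assumes "finite (arcs D)"
  shows "(\<Sum>x\<in>edge_ends_at D v. signed_value \<phi> x) =
    (\<Sum>e\<in>out_arcs D v - in_arcs D v. \<phi> e) - (\<Sum>e\<in>in_arcs D v - out_arcs D v. \<phi> e)"
proof -
  let ?O = "out_arcs D v" and ?I = "in_arcs D v"
  have fin: "finite ?O" "finite ?I"
    using assms by (auto intro: finite_subset[rotated] simp: out_arcs_def in_arcs_def)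
  have "(\<Sum>x\<in>edge_ends_at D v. signed_value \<phi> x) = sum \<phi> ?O - sum \<phi> ?I"
    using fin by (simp add: edge_ends_at_def sum.Plus sum_negf)
  also have "sum \<phi> ?O = sum \<phi> (?O - ?I) + sum \<phi> (?O \<inter> ?I)"
    using sum.Int_Diff[OF fin(1), of \<phi> ?I] by simp
  also have "sum \<phi> ?I = sum \<phi> (?I - ?O) + sum \<phi> (?O \<inter> ?I)"
    using sum.Int_Diff[OF fin(2), of \<phi> ?O] by (simp add: Int_commute)
  finally show ?thesis by simp
qed

text \<open>The edges meeting \<open>v\<close> are the union of outgoing and incoming arcs, the
  loops their intersection; the two sizes add up to the number of ends.\<close>

lemma card_edge_ends_at:
  assumes "orientation_of D G" "finite_multigraph G"
  shows "card (edge_ends_at D v) = degree G v"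
proof -
  let ?O = "out_arcs D v" and ?I = "in_arcs D v"
  have D: "arcs D = edges G" "\<And>e. e \<in> edges G \<Longrightarrow> ends G e = Upair (tail D e) (head D e)"
    and "finite (edges G)"
    using assms by (auto simp: orientation_of_def finite_multigraph_def)
  then have fin: "finite ?O" "finite ?I"
    by (auto intro: finite_subset[rotated] simp: out_arcs_def in_arcs_def)
  have "{e \<in> edges G. v \<in> set_uprod (ends G e)} = ?O \<union> ?I"
    using D by (auto simp: out_arcs_def in_arcs_def)
  moreover have "{e \<in> edges G. ends G e = Upair v v} = ?O \<inter> ?I"
    using D by (auto simp: out_arcs_def in_arcs_def)
  ultimately show ?thesis
    using fin by (simp add: degree_def edge_ends_at_def card_Plus card_Un_Int[OF fin])
qed

text \<open>Brings conservation into the form shared with the angle condition, one sum over edge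
  ends per vertex.\<close>

lemma is_S2_flow_iff_sum_edge_ends:
  assumes "finite (arcs D)"
  shows "is_S2_flow D \<phi> \<longleftrightarrow> (\<forall>e\<in>arcs D. norm (\<phi> e) = 1) \<and>
    (\<forall>v\<in>verts D. (\<Sum>x\<in>edge_ends_at D v. signed_value \<phi> x) = 0)"
  by (auto simp: is_S2_flow_def is_flow_def sum_signed_value[OF assms])

text \<open>The tangent of an edge end at \<open>v\<close> is the signed value crossed with \<open>p v\<close>. On the plane
  orthogonal to \<open>p v\<close> this is a quarter turn, so it preserves inner products.\<close>

lemma equiangular_iff_sum_edge_ends:
  assumes "orientation_of D G" "finite_multigraph G" "cubic G"
    and imm: "is_S2_immersion D p A" and ax: "\<And>e. e \<in> arcs D \<Longrightarrow> arc_axis (A e) (\<phi> e)"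
  shows "equiangular D A \<longleftrightarrow>
    (\<forall>v\<in>verts D. (\<Sum>x\<in>edge_ends_at D v. signed_value \<phi> x) = 0)"
proof -
  have "(\<forall>x\<in>edge_ends_at D v. \<forall>y\<in>edge_ends_at D v.
      x \<noteq> y \<longrightarrow> spherical_angle (short_arc A x) (short_arc A y) = 2 * pi / 3) \<longleftrightarrow>
      (\<Sum>x\<in>edge_ends_at D v. signed_value \<phi> x) = 0" if v: "v \<in> verts D" for v
  proof -
    let ?E = "edge_ends_at D v" and ?u = "signed_value \<phi>"
    have card: "card ?E = 3"
      using card_edge_ends_at[OF assms(1,2), of v] assms(1,3) v
      by (simp add: cubic_def orientation_of_def)
    have "norm (p v) = 1" using imm v by (simp add: is_S2_immersion_def)
    have u: "norm (?u x) = 1 \<and> ?u x \<bullet> p v = 0 \<and>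
        initial_unit_tangent (short_arc A x) = cross3 (?u x) (p v)" if "x \<in> ?E" for x
      using that imm ax
      by (auto simp: edge_ends_at_def is_S2_immersion_def arc_axis_def)
    \<comment> \<open>In \<open>dot_cross\<close> the mixed terms vanish by orthogonality to
      \<open>p v\<close>, and the factor \<open>p v \<bullet> p v\<close> is 1.\<close>
    have "spherical_angle (short_arc A x) (short_arc A y) = arccos (?u x \<bullet> ?u y)"
      if "x \<in> ?E" "y \<in> ?E" for x y
      using u[OF that(1)] u[OF that(2)] \<open>norm (p v) = 1\<close>
      by (simp add: spherical_angle_def dot_cross norm_eq_1)
    then show ?thesis
      using unit_triple_sum_eq_0_iff[OF card, of ?u] u by auto
  qed
  then show ?thesis by (simp add: equiangular_def)
qed

section \<open>From a flow to an immersion\<close>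

lemma S2_flow_imp_equiangular:
  assumes D: "orientation_of D G" and G: "finite_multigraph G" "cubic G"
    and flow: "is_S2_flow D \<phi>"
  obtains p A where "is_S2_immersion D p A" "equiangular D A"
proof -
  have vD: "verts D = vertices G" and eD: "arcs D = edges G"
    and ends: "\<And>e. e \<in> edges G \<Longrightarrow> ends G e = Upair (tail D e) (head D e)"
    and fin: "finite (arcs D)"
    using D G by (auto simp: orientation_of_def finite_multigraph_def)
  have in_verts: "tail D e \<in> verts D" "head D e \<in> verts D" if "e \<in> arcs D" for e
    using that G ends[of e] by (auto simp: finite_multigraph_def vD eD)
  have unit: "norm (\<phi> e) = 1" if "e \<in> arcs D" for e
    using flow that by (simp add: is_S2_flow_iff_sum_edge_ends[OF fin])
  have sum0: "\<forall>v\<in>verts D. (\<Sum>x\<in>edge_ends_at D v. signed_value \<phi> x) = 0"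
    using flow by (simp add: is_S2_flow_iff_sum_edge_ends[OF fin])
  \<comment> \<open>Normals are chosen independently at the vertices; either sign will do, since the
    arcs only need end points orthogonal to the flow value.\<close>
  have "\<exists>q. norm q = 1 \<and> (\<forall>x\<in>edge_ends_at D v. signed_value \<phi> x \<bullet> q = 0)"
    if v: "v \<in> verts D" for v
  proof (rule unit_orthogonal_triple_exists)
    show "card (edge_ends_at D v) = 3"
      using card_edge_ends_at[OF D G(1), of v] G(2) v by (simp add: cubic_def vD)
  qed (use sum0 v in auto)
  then obtain p where p: "\<And>v. v \<in> verts D \<Longrightarrow> norm (p v) = 1"
    "\<And>v x. v \<in> verts D \<Longrightarrow> x \<in> edge_ends_at D v \<Longrightarrow> signed_value \<phi> x \<bullet> p v = 0"
    by metis
  have "\<exists>B. directed_geodesic_arc B \<and> pathstart B = p (tail D e) \<and> pathfinish B = p (head D e) \<and>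
      arc_axis B (\<phi> e)" if e: "e \<in> arcs D" for e
  proof -
    have ends_e: "Inl e \<in> edge_ends_at D (tail D e)" "Inr e \<in> edge_ends_at D (head D e)"
      using e by (auto simp: edge_ends_at_def)
    have "\<phi> e \<bullet> p (tail D e) = 0"
      using p(2)[OF in_verts(1)[OF e] ends_e(1)] by simp
    moreover have "\<phi> e \<bullet> p (head D e) = 0"
      using p(2)[OF in_verts(2)[OF e] ends_e(2)] by simp
    ultimately show ?thesis
      by (metis directed_geodesic_arc_exists p(1) in_verts[OF e] unit[OF e])
  qed
  then obtain A where A: "\<And>e. e \<in> arcs D \<Longrightarrow> directed_geodesic_arc (A e) \<and>
      pathstart (A e) = p (tail D e) \<and> pathfinish (A e) = p (head D e) \<and> arc_axis (A e) (\<phi> e)"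
    by metis
  have imm: "is_S2_immersion D p A"
    using A p(1) by (simp add: is_S2_immersion_def)
  moreover have "equiangular D A"
    using equiangular_iff_sum_edge_ends[OF D G imm] A sum0 by blast
  ultimately show thesis by (rule that)
qed

theorem theorem1p4:
  fixes G :: "('v, 'e) multigraph"
  assumes "finite_multigraph G" and "cubic G"
  shows "has_equiangular_S2_immersion G \<longleftrightarrow> has_S2_flow G"
proof
  assume "has_equiangular_S2_immersion G"
  then obtain D p A where D: "orientation_of D G" and imm: "is_S2_immersion D p A"
    and eq: "equiangular D A"
    by (auto simp: has_equiangular_S2_immersion_def)
  have fin: "finite (arcs D)"
    using D assms(1) by (simp add: orientation_of_def finite_multigraph_def)
  have "\<exists>n. arc_axis (A e) n" if "e \<in> arcs D" for e
    using imm that by (metis directed_geodesic_arc_axis is_S2_immersion_def)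
  \<comment> \<open>The axis of each arc becomes its flow value.\<close>
  then obtain \<phi> where \<phi>: "\<And>e. e \<in> arcs D \<Longrightarrow> arc_axis (A e) (\<phi> e)" by metis
  then have "is_S2_flow D \<phi>"
    using eq equiangular_iff_sum_edge_ends[OF D assms imm \<phi>]
    by (simp add: is_S2_flow_iff_sum_edge_ends[OF fin] arc_axis_def)
  then show "has_S2_flow G" using D by (auto simp: has_S2_flow_def)
next
  assume "has_S2_flow G"
  then show "has_equiangular_S2_immersion G"
    using S2_flow_imp_equiangular[OF _ assms]
    by (auto simp: has_S2_flow_def has_equiangular_S2_immersion_def) metis
qed

end
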